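(* Let $n\ge 2$. If $u$ is a real homogeneous polynomial of degree $3$ in $\mathbb{R}^n$ and $\Delta_p u(x)=0$ for $p>1$, $p\ne 2$, then $u(x)\equiv 0$. More precisely, if $u(x)$ is a homogeneous polynomial solution of degree three of $$\Delta_p u:=|Du|^2\,\Delta u+\frac{p-2}{2}\,\langle Du,\,D|Du|^2\rangle=0$$ in $\mathbb{R}^n$, $n\ge 2$, and $p\notin\{0,2\}$, then $u(x)\equiv 0$.
   Context: Here $p$ is a real number, $\langle\cdot,\cdot\rangle$ is the standard inner product on $\mathbb{R}^n$, $|\cdot|$ the associated norm, $Du$ the gradient of $u$, $D|Du|^2$ the gradient of the function $x\mapsto |Du(x)|^2$, and $\Delta u$ the Laplacian of $u$. The displayed equation is the $p$-Laplace equation.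
   Formalization: The excluded exponents are p = 1 and p = 2 instead of p = 0 and p = 2: at p = 1 the claim is false, since u(x) = x_1^3 is a nonzero cubic solution in every dimension, while p = 0 needs no exclusion and is covered. *)

theory Defs
  imports "HOL-Analysis.Analysis"
begin

(* alpha ranges over the exponent vectors with |alpha| = d (a finite set, see below), so these
   are the forms of degree d, with the zero polynomial included for every d. *)
definition homogeneous_polynomial :: "nat \<Rightarrow> (real ^ 'n \<Rightarrow> real) \<Rightarrow> bool" where
  "homogeneous_polynomial d u \<longleftrightarrow>
     (\<exists>c :: ('n \<Rightarrow> nat) \<Rightarrow> real. \<forall>x.
        u x = (\<Sum>\<alpha> | (\<Sum>i\<in>UNIV. \<alpha> i) = d. c \<alpha> * (\<Prod>i\<in>UNIV. (x $ i) ^ \<alpha> i)))"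

(* Only meaningful where f is differentiable. *)
definition gradient :: "(real ^ 'n \<Rightarrow> real) \<Rightarrow> real ^ 'n \<Rightarrow> real ^ 'n" where
  "gradient f x = (THE D. GDERIV f x :> D)"

definition laplacian :: "(real ^ 'n \<Rightarrow> real) \<Rightarrow> real ^ 'n \<Rightarrow> real" where
  "laplacian f x = (\<Sum>i\<in>UNIV. gradient (\<lambda>y. gradient f y $ i) x $ i)"

definition p_laplacian :: "real \<Rightarrow> (real ^ 'n \<Rightarrow> real) \<Rightarrow> real ^ 'n \<Rightarrow> real" where
  "p_laplacian p u x =
     (norm (gradient u x))\<^sup>2 * laplacian u x
     + (p - 2) / 2 * (gradient u x \<bullet> gradient (\<lambda>y. (norm (gradient u y))\<^sup>2) x)"

lemma finite_exponents: "finite {\<alpha> :: 'n::finite \<Rightarrow> nat. (\<Sum>i\<in>UNIV. \<alpha> i) = d}"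
proof (rule finite_subset)
  show "{\<alpha> :: 'n \<Rightarrow> nat. (\<Sum>i\<in>UNIV. \<alpha> i) = d} \<subseteq> PiE UNIV (\<lambda>_. {..d})"
    by (auto intro: member_le_sum)
  show "finite (PiE (UNIV :: 'n set) (\<lambda>_. {..d}))"
    by (intro finite_PiE) auto
qed

lemma gradient_eqI:
  assumes "GDERIV f x :> D"
  shows "gradient f x = D"
  unfolding gradient_def
proof (rule the_equality)
  fix E assume "GDERIV f x :> E"
  with assms have "(\<lambda>h. h \<bullet> E) = (\<lambda>h. h \<bullet> D)"
    unfolding gderiv_def by (metis has_derivative_unique)
  then have "(E - D) \<bullet> (E - D) = 0"
    by (metis inner_diff_right right_minus_eq)
  then show "E = D" by simp
qed (fact assms)

lemma gradient_component_power:
  "gradient (\<lambda>x :: real ^ 'n. a * (x $ k) ^ m) x = axis k (a * (real m * (x $ k) ^ (m - 1)))"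
proof (rule gradient_eqI)
  have [derivative_intros]: "((\<lambda>x :: real ^ 'n. x $ k) has_derivative (\<lambda>h. h $ k)) (at x)"
    by (rule bounded_linear_imp_has_derivative) (rule bounded_linear_vec_nth)
  show "GDERIV (\<lambda>x. a * (x $ k) ^ m) x :> axis k (a * (real m * (x $ k) ^ (m - 1)))"
    unfolding gderiv_def inner_axis
    by (auto simp: ac_simps intro!: derivative_eq_intros)
qed

(* For p = 1 the cube of a coordinate is a nonzero solution in every dimension, so a
   nonexistence theorem for cubic solutions must exclude p = 1. *)
lemma p_laplacian_1_cube:
  fixes k :: "'n::finite"
  shows "homogeneous_polynomial 3 (\<lambda>x :: real ^ 'n. (x $ k) ^ 3)"
    and "p_laplacian 1 (\<lambda>x :: real ^ 'n. (x $ k) ^ 3) x = 0"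
proof -
  define e where "e = (\<lambda>i. if i = k then 3 else 0 :: nat)"
  have e: "e \<in> {\<alpha>. (\<Sum>i\<in>UNIV. \<alpha> i) = 3}"
    by (simp add: e_def)
  have "(x $ k) ^ 3 = (\<Sum>\<alpha> | (\<Sum>i\<in>UNIV. \<alpha> i) = 3.
      (if \<alpha> = e then 1 else 0) * (\<Prod>i\<in>UNIV. (x $ i) ^ \<alpha> i))" for x :: "real ^ 'n"
  proof -
    have "(\<Sum>\<alpha> | (\<Sum>i\<in>UNIV. \<alpha> i) = 3.
        (if \<alpha> = e then 1 else 0) * (\<Prod>i\<in>UNIV. (x $ i) ^ \<alpha> i))
      = (\<Sum>\<alpha> | (\<Sum>i\<in>UNIV. \<alpha> i) = 3. if e = \<alpha> then \<Prod>i\<in>UNIV. (x $ i) ^ \<alpha> i else 0)"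
      by (rule sum.cong) auto
    also have "\<dots> = (\<Prod>i\<in>UNIV. (x $ i) ^ e i)"
      using e by (subst sum.delta'[OF finite_exponents]) simp
    also have "\<dots> = (\<Prod>i\<in>UNIV. if i = k then (x $ i) ^ 3 else 1)"
      by (rule prod.cong) (auto simp: e_def)
    finally show ?thesis by simp
  qed
  then show "homogeneous_polynomial 3 (\<lambda>x :: real ^ 'n. (x $ k) ^ 3)"
    unfolding homogeneous_polynomial_def
    by (intro exI[of _ "\<lambda>\<alpha>. if \<alpha> = e then 1 else 0"]) blast
next
  have grad: "gradient (\<lambda>x :: real ^ 'n. (x $ k) ^ 3) = (\<lambda>x. axis k (3 * (x $ k) ^ 2))"
    using gradient_component_power[of 1 k 3] by (auto simp: fun_eq_iff)
  have "gradient (\<lambda>y :: real ^ 'n. axis k (3 * (y $ k) ^ 2) $ i) x $ i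
      = (if i = k then 6 * x $ k else 0)" for i
    using gradient_component_power[of 3 k 2 x] gradient_component_power[of 0 k 2 x]
    by (cases "i = k") (auto simp: axis_def vec_eq_iff)
  then have lap: "laplacian (\<lambda>x :: real ^ 'n. (x $ k) ^ 3) x = 6 * x $ k"
    by (simp add: laplacian_def grad)
  have "(\<lambda>y :: real ^ 'n. (norm (axis k (3 * (y $ k) ^ 2)))\<^sup>2) = (\<lambda>y. 9 * (y $ k) ^ 4)"
    by (simp only: power2_norm_eq_inner inner_axis_axis) (simp add: eval_nat_numeral)
  then have grad2: "gradient (\<lambda>y :: real ^ 'n. (norm (axis k (3 * (y $ k) ^ 2)))\<^sup>2) x
      = axis k (36 * (x $ k) ^ 3)"
    using gradient_component_power[of 9 k 4 x] by simp
  show "p_laplacian 1 (\<lambda>x :: real ^ 'n. (x $ k) ^ 3) x = 0"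
    unfolding p_laplacian_def grad lap grad2
    by (simp only: power2_norm_eq_inner inner_axis_axis) (simp add: eval_nat_numeral)
qed

end

theory Submission
  imports Defs
begin

text \<open>
  A cubic form \<open>u\<close> can be written as \<open>u x = (x \<star> x) \<bullet> x\<close> for a commutative, not necessarily
  associative product whose multiplication operators are self-adjoint. Its gradient is
  \<open>3 *\<^sub>R (x \<star> x)\<close> and its Hessian is six times multiplication by \<open>x\<close>, so with \<open>q = p - 2\<close> the
  p-Laplace equation becomes the identity
  \<open>((x \<star> x) \<bullet> (x \<star> x)) * trace x + q * ((x \<star> x) \<bullet> (x \<star> (x \<star> x))) = 0\<close>,
  where \<open>trace x\<close> is the trace of multiplication by \<open>x\<close> (\<open>p_laplacian_cubic\<close>).

  Suppose that \<open>u\<close> is not zero. A maximum point \<open>e\<close> of \<open>u\<close> on the unit sphere satisfies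
  \<open>e \<star> e = M *\<^sub>R e\<close> with \<open>M \<noteq> 0\<close>; it is an idempotent up to scaling. Let \<open>L\<close> denote
  multiplication by \<open>e\<close>. The identity at \<open>e\<close> says that \<open>L\<close> has trace \<open>- q * M\<close>. Its second
  order term at \<open>e\<close> in a direction \<open>y\<close> orthogonal to \<open>e\<close> collapses to \<open>4 * q\<close> times
  \<open>L y \<bullet> L (L y)\<close> (\<open>cube_form_vanishes\<close>). As \<open>q \<noteq> 0\<close>, the self-adjoint operator \<open>L\<^sup>3\<close> has
  zero quadratic form on the complement of \<open>e\<close>, so \<open>L\<close> is zero there. Then the trace of
  \<open>L\<close> is its only remaining eigenvalue \<open>M\<close>, and \<open>M = - q * M\<close> forces \<open>q = - 1\<close>, that is,
  \<open>p = 1\<close>. The two excluded exponents are exactly those at which one of the two steps fails.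
\<close>

section \<open>Monomials\<close>

lemma monomial_split_variable:
  fixes \<alpha> :: "'n::finite \<Rightarrow> nat"
  assumes "(\<Sum>l\<in>UNIV. \<alpha> l) = Suc d"
  obtains i \<beta> where "(\<Sum>l\<in>UNIV. \<beta> l) = d"
    "\<And>x :: real ^ 'n. (\<Prod>l\<in>UNIV. (x $ l) ^ \<alpha> l) = x $ i * (\<Prod>l\<in>UNIV. (x $ l) ^ \<beta> l)"
proof -
  have "\<exists>i. \<alpha> i \<noteq> 0"
    using assms by (metis sum.neutral Zero_not_Suc)
  then obtain i m where i: "\<alpha> i = Suc m"
    using not0_implies_Suc by blast
  define \<beta> where "\<beta> = \<alpha>(i := m)"
  have rest: "(\<Sum>l\<in>UNIV - {i}. \<beta> l) = (\<Sum>l\<in>UNIV - {i}. \<alpha> l)"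
    "(\<Prod>l\<in>UNIV - {i}. (x $ l) ^ \<beta> l) = (\<Prod>l\<in>UNIV - {i}. (x $ l) ^ \<alpha> l)" for x :: "real ^ 'n"
    by (auto simp: \<beta>_def intro: sum.cong prod.cong)
  show thesis
  proof
    show "(\<Sum>l\<in>UNIV. \<beta> l) = d"
      using assms by (simp add: sum.remove[of UNIV i] rest(1) i) (simp add: \<beta>_def)
    show "(\<Prod>l\<in>UNIV. (x $ l) ^ \<alpha> l) = x $ i * (\<Prod>l\<in>UNIV. (x $ l) ^ \<beta> l)" for x :: "real ^ 'n"
      by (simp add: prod.remove[of UNIV i] rest(2) i) (simp add: \<beta>_def)
  qed
qed

lemma cubic_monomial:
  fixes \<alpha> :: "'n::finite \<Rightarrow> nat"
  assumes "(\<Sum>l\<in>UNIV. \<alpha> l) = 3"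
  shows "\<exists>i j k. \<forall>x :: real ^ 'n. (\<Prod>l\<in>UNIV. (x $ l) ^ \<alpha> l) = x $ i * x $ j * x $ k"
proof -
  obtain i \<beta> where \<beta>: "(\<Sum>l\<in>UNIV. \<beta> l) = 2"
    "\<And>x :: real ^ 'n. (\<Prod>l\<in>UNIV. (x $ l) ^ \<alpha> l) = x $ i * (\<Prod>l\<in>UNIV. (x $ l) ^ \<beta> l)"
    by (rule monomial_split_variable[of \<alpha> 2]) (use assms in auto)
  obtain j \<gamma> where \<gamma>: "(\<Sum>l\<in>UNIV. \<gamma> l) = 1"
    "\<And>x :: real ^ 'n. (\<Prod>l\<in>UNIV. (x $ l) ^ \<beta> l) = x $ j * (\<Prod>l\<in>UNIV. (x $ l) ^ \<gamma> l)"
    by (rule monomial_split_variable[of \<beta> 1]) (use \<beta>(1) in auto)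
  obtain k \<delta> where \<delta>: "(\<Sum>l\<in>UNIV. \<delta> l) = 0"
    "\<And>x :: real ^ 'n. (\<Prod>l\<in>UNIV. (x $ l) ^ \<gamma> l) = x $ k * (\<Prod>l\<in>UNIV. (x $ l) ^ \<delta> l)"
    by (rule monomial_split_variable[of \<gamma> 0]) (use \<gamma>(1) in auto)
  from \<delta>(1) have "\<delta> l = 0" for l by simp
  then show ?thesis
    by (auto simp: \<beta>(2) \<gamma>(2) \<delta>(2) mult.assoc)
qed

section \<open>Commutative algebras with an invariant inner product\<close>

text \<open>
  The even part has three coefficients, which the values at \<open>0\<close>, \<open>\<plusminus>1\<close>, \<open>\<plusminus>2\<close> determine.
\<close>
lemma quintic_square_coeff_zero:
  fixes a0 a1 a2 a3 a4 a5 :: real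
  assumes "\<And>t. a0 + a1 * t + a2 * t\<^sup>2 + a3 * t ^ 3 + a4 * t ^ 4 + a5 * t ^ 5 = 0"
  shows "a2 = 0"
  using assms[of 0] assms[of 1] assms[of "- 1"] assms[of 2] assms[of "- 2"] by simp

text \<open>
  This is the coordinate-free form of a cubic form: a symmetric trilinear form
  \<open>T\<close> on a Euclidean space is the same thing as a commutative bilinear product with
  \<open>T x y z = (x \<star> y) \<bullet> z\<close>, and the symmetry of \<open>T\<close> says that every multiplication operator
  \<open>\<lambda>y. x \<star> y\<close> is self-adjoint. These operators are, up to a factor, the Hessians of the
  cubic form. The product need not be associative.
\<close>
locale metrized_algebra = bounded_bilinear mult
  for mult :: "'a::euclidean_space \<Rightarrow> 'a \<Rightarrow> 'a" (infixl "\<star>" 70) +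
  assumes commute: "x \<star> y = y \<star> x"
    and invariant: "(x \<star> y) \<bullet> z = x \<bullet> (y \<star> z)"
begin

definition cubic :: "'a \<Rightarrow> real" where
  "cubic x = (x \<star> x) \<bullet> x"

definition mult_trace :: "'a \<Rightarrow> real" where
  "mult_trace x = (\<Sum>b\<in>Basis. (x \<star> b) \<bullet> b)"

lemmas mult_simps = add_left add_right diff_left diff_right scaleR_left scaleR_right
  minus_left minus_right zero_left zero_right

lemma self_adjoint: "(x \<star> y) \<bullet> z = y \<bullet> (x \<star> z)"
  by (metis commute invariant)

lemma square_has_derivative:
  "((\<lambda>x. x \<star> x) has_derivative (\<lambda>h. 2 *\<^sub>R (x \<star> h))) (at x)"
  by (rule has_derivative_eq_rhs[OF FDERIV[OF has_derivative_ident has_derivative_ident]])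
    (simp add: fun_eq_iff commute[of _ x] scaleR_2)

lemma cubic_has_derivative:
  "(cubic has_derivative (\<lambda>h. h \<bullet> (3 *\<^sub>R (x \<star> x)))) (at x)"
proof -
  have "x \<bullet> (x \<star> h) = h \<bullet> (x \<star> x)" for h
    using self_adjoint[of x x h] by (simp add: inner_commute)
  then show ?thesis
    unfolding cubic_def
    by (intro has_derivative_eq_rhs[OF has_derivative_inner[OF square_has_derivative has_derivative_ident]])
      (simp add: fun_eq_iff self_adjoint)
qed

lemma cubic_scaleR: "cubic (a *\<^sub>R x) = a ^ 3 * cubic x"
  by (simp add: cubic_def scaleR_left scaleR_right power3_eq_cube)

lemma mult_trace_add: "mult_trace (x + y) = mult_trace x + mult_trace y"
  by (simp add: mult_trace_def add_left inner_add_left sum.distrib)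

lemma mult_trace_scaleR: "mult_trace (a *\<^sub>R x) = a * mult_trace x"
  by (simp add: mult_trace_def scaleR_left sum_distrib_left)

text \<open>
  The vector \<open>e\<close> is a maximum point of the cubic form on the unit sphere, where Lagrange's
  condition says that the gradient \<open>3 *\<^sub>R (e \<star> e)\<close> is a multiple of \<open>e\<close>.
\<close>
lemma exists_unit_square_proportional:
  assumes "cubic v \<noteq> 0"
  obtains e M where "norm e = 1" "M \<noteq> 0" "e \<star> e = M *\<^sub>R e"
proof -
  have cont: "continuous_on (sphere 0 1) cubic"
    using cubic_has_derivative has_derivative_continuous continuous_at_imp_continuous_on by blast
  have "v \<noteq> 0"
    using assms by (auto simp: cubic_def)
  then have "v /\<^sub>R norm v \<in> sphere 0 1"
    by simp
  then obtain e where e: "e \<in> sphere 0 1" and max: "\<And>x. x \<in> sphere 0 1 \<Longrightarrow> cubic x \<le> cubic e"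
    using continuous_attains_sup[OF compact_sphere _ cont] by blast
  define M where "M = cubic e"
  have ee: "e \<bullet> e = 1"
    using e by (simp add: dot_square_norm)
  \<comment> \<open>Homogeneity turns the constrained maximum into a global inequality between polynomials,
    with equality at \<open>e\<close>; squaring makes both sides polynomial.\<close>
  have bound: "(cubic x)\<^sup>2 \<le> M\<^sup>2 * (x \<bullet> x) ^ 3" for x
  proof (cases "x = 0")
    case False
    define w where "w = x /\<^sub>R norm x"
    have w: "w \<in> sphere 0 1" and x: "x = norm x *\<^sub>R w"
      using False by (auto simp: w_def)
    have "cubic (- w) = - cubic w"
      using cubic_scaleR[of "- 1" w] by simp
    then have "\<bar>cubic w\<bar> \<le> \<bar>M\<bar>"
      using max[OF w] max[of "- w"] w unfolding M_def by auto
    then have "(cubic w)\<^sup>2 \<le> M\<^sup>2"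
      by (rule abs_le_square_iff[THEN iffD1])
    moreover have "(cubic x)\<^sup>2 = (cubic w)\<^sup>2 * (x \<bullet> x) ^ 3"
      by (subst x, subst cubic_scaleR)
        (simp add: power2_norm_eq_inner[symmetric] power_mult_distrib flip: power_mult)
    ultimately show ?thesis
      by (simp add: mult_right_mono)
  qed (simp add: cubic_def)
  have "M \<noteq> 0"
    using bound[of v] assms by auto
  define G where "G x = M\<^sup>2 * (x \<bullet> x) ^ 3 - (cubic x)\<^sup>2" for x
  have "(G has_derivative
      (\<lambda>h. M\<^sup>2 * (3 * (e \<bullet> h + h \<bullet> e) * (e \<bullet> e)\<^sup>2) - 2 * (h \<bullet> (3 *\<^sub>R (e \<star> e))) * cubic e)) (at e)"
    unfolding G_def
    by (auto intro!: derivative_eq_intros cubic_has_derivative)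
  then have der: "(G has_derivative (\<lambda>h. 6 * M * (h \<bullet> (M *\<^sub>R e - e \<star> e)))) (at e)"
    by (rule has_derivative_eq_rhs)
      (simp add: fun_eq_iff ee M_def[symmetric] inner_diff_right inner_commute power2_eq_square
        algebra_simps)
  have "G e \<le> G x" for x
    using bound[of x] by (simp add: G_def ee M_def)
  then have "(\<lambda>h. 6 * M * (h \<bullet> (M *\<^sub>R e - e \<star> e))) = (\<lambda>h. 0)"
    by (intro differential_zero_maxmin[OF _ open_UNIV der]) auto
  then have "6 * M * ((M *\<^sub>R e - e \<star> e) \<bullet> (M *\<^sub>R e - e \<star> e)) = 0"
    by (rule fun_cong)
  with \<open>M \<noteq> 0\<close> have "e \<star> e = M *\<^sub>R e"
    by simp
  with that show thesis
    using e \<open>M \<noteq> 0\<close> by auto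
qed

text \<open>
  The identity is expanded along the line \<open>e + t *\<^sub>R y\<close>, and the coefficient of \<open>t\<^sup>2\<close> is read
  off. Write \<open>L\<close> for multiplication by \<open>e\<close>. At \<open>t = 0\<close> the identity gives the value
  \<open>- q * M\<close> for the trace of \<open>L\<close>. The linear term of the trace does not contribute to the
  coefficient of \<open>t\<^sup>2\<close>, because the squared norm of \<open>x \<star> x\<close> has no linear term when \<open>y\<close> is
  orthogonal to \<open>e\<close>. With the value of the trace inserted, everything of order one and two in
  \<open>L\<close> cancels and only \<open>4 * q\<close> times the cubic expression \<open>L y \<bullet> L (L y)\<close> remains.
\<close>
lemma cube_form_vanishes:
  assumes eq: "\<And>x. (x \<star> x) \<bullet> (x \<star> x) * mult_trace x + q * ((x \<star> x) \<bullet> (x \<star> (x \<star> x))) = 0"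
    and "q \<noteq> 0" "norm e = 1" "M \<noteq> 0" and ee: "e \<star> e = M *\<^sub>R e" and y: "e \<bullet> y = 0"
  shows "(e \<star> y) \<bullet> (e \<star> (e \<star> y)) = 0"
proof -
  have n: "e \<bullet> e = 1"
    using \<open>norm e = 1\<close> by (simp add: dot_square_norm)
  have tr: "mult_trace e = - (q * M)"
  proof -
    have "M\<^sup>2 * (mult_trace e + q * M) = 0"
      using eq[of e] by (simp add: ee n scaleR_right power2_eq_square algebra_simps)
    with \<open>M \<noteq> 0\<close> show ?thesis by simp
  qed
  define a where "a = e \<star> y"
  define b where "b = y \<star> y"
  define z where "z t = M *\<^sub>R e + (2 * t) *\<^sub>R a + t\<^sup>2 *\<^sub>R b" for t
  have sq: "(e + t *\<^sub>R y) \<star> (e + t *\<^sub>R y) = z t" for t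
    unfolding z_def mult_2 scaleR_add_left a_def b_def
    by (simp add: mult_simps ee commute[of y e] power2_eq_square scaleR_add_right add.assoc)
  have ye: "y \<star> e = a"
    by (simp add: a_def commute)
  have e_a: "e \<bullet> a = 0"
    using invariant[of e e y] y by (simp add: ee a_def)
  have e_b: "e \<bullet> b = y \<bullet> a"
    using invariant[of e y y] by (simp add: a_def b_def inner_commute)
  have e_ea: "e \<bullet> (e \<star> a) = 0" and e_eb: "e \<bullet> (e \<star> b) = M * (y \<bullet> a)"
    using invariant[of e e a] invariant[of e e b] by (simp_all add: ee e_a e_b)
  have e_ya: "e \<bullet> (y \<star> a) = a \<bullet> a" and e_yb: "e \<bullet> (y \<star> b) = a \<bullet> b"
    using invariant[of e y a] invariant[of e y b] by (simp_all add: a_def)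
  have b_ea: "b \<bullet> (e \<star> a) = a \<bullet> (e \<star> b)"
    using self_adjoint[of e b a] by (simp add: inner_commute)
  define \<sigma> where "\<sigma> = mult_trace y"
  have norm_sq: "z t \<bullet> z t = M\<^sup>2 + t\<^sup>2 * (4 * (a \<bullet> a) + 2 * M * (y \<bullet> a))
      + t ^ 3 * (4 * (a \<bullet> b)) + t ^ 4 * (b \<bullet> b)" for t
    unfolding z_def
    by (simp add: inner_add_left inner_add_right n e_a e_b inner_commute[of a e]
        inner_commute[of b e] inner_commute[of b a] power_numeral_reduce algebra_simps)
  have via_e: "z t \<bullet> (e \<star> z t) = M ^ 3 + t\<^sup>2 * (2 * M\<^sup>2 * (y \<bullet> a) + 4 * (a \<bullet> (e \<star> a)))
      + t ^ 3 * (4 * (a \<bullet> (e \<star> b))) + t ^ 4 * (b \<bullet> (e \<star> b))" for t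
    unfolding z_def
    by (simp add: mult_simps ee inner_add_left inner_add_right n e_a e_b e_ea e_eb b_ea
        inner_commute[of a e] inner_commute[of b e] power_numeral_reduce algebra_simps)
  have via_y: "z t \<bullet> (y \<star> z t) = t * (4 * M * (a \<bullet> a))
      + t\<^sup>2 * (2 * M * (a \<bullet> b) + 4 * (a \<bullet> (y \<star> a)))
      + t ^ 3 * (2 * (a \<bullet> (y \<star> b)) + 2 * (b \<bullet> (y \<star> a))) + t ^ 4 * (b \<bullet> (y \<star> b))" for t
    unfolding z_def
    by (simp add: mult_simps ye inner_add_left inner_add_right e_a e_ya e_yb
        inner_commute[of b a] power_numeral_reduce algebra_simps)
  have "(z t \<bullet> z t) * (t * \<sigma> - q * M) + q * (z t \<bullet> (e \<star> z t) + t * (z t \<bullet> (y \<star> z t))) = 0" for t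
    using eq[of "e + t *\<^sub>R y"] unfolding sq
    by (simp add: mult_trace_add mult_trace_scaleR tr \<sigma>_def add_left scaleR_left inner_add_right)
  note poly = this[unfolded norm_sq via_e via_y]
  have "4 * (q * (a \<bullet> (e \<star> a))) = 0"
  proof (rule quintic_square_coeff_zero)
    fix t :: real
    show "0 + M\<^sup>2 * \<sigma> * t + 4 * (q * (a \<bullet> (e \<star> a))) * t\<^sup>2
      + (\<sigma> * (4 * (a \<bullet> a) + 2 * M * (y \<bullet> a)) - 4 * q * M * (a \<bullet> b)
          + q * (4 * (a \<bullet> (e \<star> b)) + 2 * M * (a \<bullet> b) + 4 * (a \<bullet> (y \<star> a)))) * t ^ 3
      + (4 * \<sigma> * (a \<bullet> b) - q * M * (b \<bullet> b)
          + q * (b \<bullet> (e \<star> b) + 2 * (a \<bullet> (y \<star> b)) + 2 * (b \<bullet> (y \<star> a)))) * t ^ 4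
      + (\<sigma> * (b \<bullet> b) + q * (b \<bullet> (y \<star> b))) * t ^ 5 = 0"
      using poly[of t] by (simp add: power_numeral_reduce algebra_simps)
  qed
  with \<open>q \<noteq> 0\<close> show ?thesis
    by (simp add: a_def)
qed

text \<open>
  The hypothesis says that the quadratic form of the self-adjoint operator \<open>L\<^sup>3\<close>, where \<open>L\<close> is
  multiplication by \<open>e\<close>, vanishes on the complement of \<open>e\<close>, which \<open>L\<close> preserves. By
  polarization \<open>L\<^sup>3\<close> itself vanishes there, and a nilpotent self-adjoint operator is zero.
\<close>
lemma mult_zero_on_complement:
  assumes cube: "\<And>y. e \<bullet> y = 0 \<Longrightarrow> (e \<star> y) \<bullet> (e \<star> (e \<star> y)) = 0"
    and ee: "e \<star> e = M *\<^sub>R e" and y: "e \<bullet> y = 0"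
  shows "e \<star> y = 0"
proof -
  have perp: "e \<bullet> (e \<star> z) = 0" if "e \<bullet> z = 0" for z
    using that by (simp add: ee flip: invariant)
  have polar: "(e \<star> (e \<star> z)) \<bullet> (e \<star> w) = 0" if "e \<bullet> z = 0" "e \<bullet> w = 0" for z w
  proof -
    have "e \<bullet> (z + w) = 0"
      using that by (simp add: inner_add_right)
    moreover have "w \<bullet> (e \<star> (e \<star> (e \<star> z))) = z \<bullet> (e \<star> (e \<star> (e \<star> w)))"
      by (metis self_adjoint inner_commute)
    ultimately show ?thesis
      using cube[of "z + w"] cube[OF that(1)] cube[OF that(2)]
      by (simp add: add_right inner_add_left inner_add_right self_adjoint inner_commute)
  qed
  have "e \<star> (e \<star> y) = 0"
    using polar[OF y perp[OF y]] by simp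
  then have "(e \<star> y) \<bullet> (e \<star> y) = 0"
    by (simp add: self_adjoint)
  then show ?thesis by simp
qed

lemma mult_trace_rank_one:
  assumes zero: "\<And>y. e \<bullet> y = 0 \<Longrightarrow> e \<star> y = 0"
    and "norm e = 1" and ee: "e \<star> e = M *\<^sub>R e"
  shows "mult_trace e = M"
proof -
  have n: "e \<bullet> e = 1"
    using \<open>norm e = 1\<close> by (simp add: dot_square_norm)
  have "e \<star> b = ((e \<bullet> b) * M) *\<^sub>R e" for b
  proof -
    have "e \<star> (b - (e \<bullet> b) *\<^sub>R e) = 0"
      by (rule zero) (simp add: inner_diff_right n)
    then show ?thesis
      by (simp add: diff_right scaleR_right ee)
  qed
  then have "mult_trace e = (\<Sum>b\<in>Basis. M * ((e \<bullet> b) * (e \<bullet> b)))"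
    by (simp add: mult_trace_def mult_ac)
  also have "\<dots> = M * (e \<bullet> e)"
    by (simp add: euclidean_inner[of e e] sum_distrib_left)
  finally show ?thesis
    by (simp add: n)
qed

text \<open>
  The trace of multiplication by the vector \<open>e\<close> found above is computed twice: the identity at
  \<open>e\<close> makes it \<open>- q * M\<close>, and the vanishing on the complement of \<open>e\<close> makes it \<open>M\<close>. Since
  \<open>M\<close> is nonzero, only \<open>q = - 1\<close> is compatible with both.
\<close>
theorem cubic_zero_if_trace_identity:
  assumes eq: "\<And>x. (x \<star> x) \<bullet> (x \<star> x) * mult_trace x + q * ((x \<star> x) \<bullet> (x \<star> (x \<star> x))) = 0"
    and "q \<noteq> 0" "q \<noteq> - 1"
  shows "cubic v = 0"
proof (rule ccontr)
  assume "cubic v \<noteq> 0"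
  then obtain e M where e: "norm e = 1" "M \<noteq> 0" "e \<star> e = M *\<^sub>R e"
    by (rule exists_unit_square_proportional)
  have "e \<star> y = 0" if "e \<bullet> y = 0" for y
    using mult_zero_on_complement cube_form_vanishes[OF eq \<open>q \<noteq> 0\<close> e] e(3) that by blast
  then have "mult_trace e = M"
    using mult_trace_rank_one e by blast
  moreover have "e \<bullet> e = 1"
    using e(1) by (simp add: dot_square_norm)
  ultimately have "M * M * M * (1 + q) = 0"
    using eq[of e] by (simp add: e(3) scaleR_right algebra_simps)
  with \<open>M \<noteq> 0\<close> \<open>q \<noteq> - 1\<close> show False
    by auto
qed

end

section \<open>Cubic forms as algebras\<close>

lemma cubic_form_algebra:
  fixes u :: "real ^ 'n \<Rightarrow> real"
  assumes "homogeneous_polynomial 3 u"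
  obtains m where "metrized_algebra m" "u = metrized_algebra.cubic m"
proof -
  let ?A = "{\<alpha> :: 'n \<Rightarrow> nat. (\<Sum>i\<in>UNIV. \<alpha> i) = 3}"
  obtain c where c: "\<And>x. u x = (\<Sum>\<alpha>\<in>?A. c \<alpha> * (\<Prod>i\<in>UNIV. (x $ i) ^ \<alpha> i))"
    using assms unfolding homogeneous_polynomial_def by blast
  have "\<forall>\<alpha>. \<exists>i j k. \<alpha> \<in> ?A \<longrightarrow>
      (\<forall>x :: real ^ 'n. (\<Prod>l\<in>UNIV. (x $ l) ^ \<alpha> l) = x $ i * x $ j * x $ k)"
    using cubic_monomial by blast
  then obtain i j k where ijk: "\<And>\<alpha> x. \<alpha> \<in> ?A \<Longrightarrow>
      (\<Prod>l\<in>UNIV. ((x :: real ^ 'n) $ l) ^ \<alpha> l) = x $ i \<alpha> * x $ j \<alpha> * x $ k \<alpha>"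
    by metis
  \<comment> \<open>The full polarization of one monomial has six terms, whence the factor \<open>c \<alpha> / 6\<close> below;
    they are grouped by the coordinate that the third argument contributes.\<close>
  define s :: "('n \<Rightarrow> nat) \<Rightarrow> real ^ 'n \<Rightarrow> real ^ 'n \<Rightarrow> real ^ 'n" where
    "s \<alpha> x y = axis (k \<alpha>) (x $ i \<alpha> * y $ j \<alpha> + x $ j \<alpha> * y $ i \<alpha>)
      + axis (j \<alpha>) (x $ i \<alpha> * y $ k \<alpha> + x $ k \<alpha> * y $ i \<alpha>)
      + axis (i \<alpha>) (x $ j \<alpha> * y $ k \<alpha> + x $ k \<alpha> * y $ j \<alpha>)" for \<alpha> x y
  define m where "m x y = (\<Sum>\<alpha>\<in>?A. (c \<alpha> / 6) *\<^sub>R s \<alpha> x y)" for x y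
  have s_inner: "s \<alpha> x y \<bullet> z =
      (x $ i \<alpha> * y $ j \<alpha> + x $ j \<alpha> * y $ i \<alpha>) * z $ k \<alpha>
      + (x $ i \<alpha> * y $ k \<alpha> + x $ k \<alpha> * y $ i \<alpha>) * z $ j \<alpha>
      + (x $ j \<alpha> * y $ k \<alpha> + x $ k \<alpha> * y $ j \<alpha>) * z $ i \<alpha>" for \<alpha> x y z
    by (simp add: s_def inner_add_left inner_axis' )
  have m_inner: "m x y \<bullet> z = (\<Sum>\<alpha>\<in>?A. c \<alpha> / 6 * (s \<alpha> x y \<bullet> z))" for x y z
    by (simp add: m_def inner_sum_left)
  have inv: "m x y \<bullet> z = x \<bullet> m y z" for x y z
    unfolding inner_commute[of x] m_inner s_inner
    by (rule sum.cong) (auto simp: algebra_simps)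
  have comm: "m x y = m y x" for x y
    unfolding m_def s_def by (simp add: algebra_simps)
  have lin: "linear (\<lambda>x. m x y)" for y
    by (rule linearI; rule vector_eq_rdot[THEN iffD1]) 
      (auto simp: m_inner s_inner inner_add_left algebra_simps sum_distrib_left
        intro!: sum.cong simp flip: sum.distrib)
  moreover have "m x = (\<lambda>y. m y x)" for x
    using comm by blast
  ultimately have "bilinear m"
    unfolding bilinear_def by metis
  then have alg: "metrized_algebra m"
    unfolding metrized_algebra_def metrized_algebra_axioms_def
    using inv comm by (auto simp: bilinear_conv_bounded_bilinear)
  interpret metrized_algebra m by (fact alg)
  have "u x = cubic x" for x
    unfolding cubic_def m_inner s_inner c
    by (rule sum.cong) (auto simp: ijk)
  with alg that show thesis by blast
qed

section \<open>The p-Laplace operator on cubic forms\<close>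

text \<open>
  In terms of the product, the gradient of the cubic form at \<open>x\<close> is three times the square of \<open>x\<close>,
  and its Hessian is six times multiplication by \<open>x\<close>. So the p-Laplace operator only involves the
  trace of this multiplication and the powers of \<open>x\<close>.
\<close>

context
  fixes m :: "real ^ 'n \<Rightarrow> real ^ 'n \<Rightarrow> real ^ 'n"
  assumes alg: "metrized_algebra m"
begin

interpretation metrized_algebra m by (fact alg)

lemma gradient_cubic: "gradient cubic x = 3 *\<^sub>R m x x"
  by (intro gradient_eqI) (simp add: gderiv_def cubic_has_derivative del: inner_scaleR_right)

lemma laplacian_cubic: "laplacian cubic x = 6 * mult_trace x"
proof -
  have "gradient (\<lambda>y. gradient cubic y $ i) x = 6 *\<^sub>R m x (axis i 1)" for i
  proof (rule gradient_eqI)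
    have "((\<lambda>y. (3 *\<^sub>R m y y) \<bullet> axis i 1) has_derivative
        (\<lambda>h. (3 *\<^sub>R 2 *\<^sub>R m x h) \<bullet> axis i 1)) (at x)"
      by (intro derivative_intros square_has_derivative)
    then show "GDERIV (\<lambda>y. gradient cubic y $ i) x :> 6 *\<^sub>R m x (axis i 1)"
      by (simp add: gderiv_def gradient_cubic self_adjoint cart_eq_inner_axis)
  qed
  then have "laplacian cubic x = (\<Sum>i\<in>UNIV. 6 * (m x (axis i 1) \<bullet> axis i 1))"
    by (simp add: laplacian_def cart_eq_inner_axis)
  also have "\<dots> = 6 * mult_trace x"
  proof -
    have Basis: "(Basis :: (real ^ 'n) set) = range (\<lambda>i. axis i 1)"
      by (auto simp: Basis_vec_def)
    show ?thesis
      unfolding mult_trace_def Basis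
      by (subst sum.reindex) (auto simp: inj_on_def axis_eq_axis sum_distrib_left)
  qed
  finally show ?thesis .
qed

lemma p_laplacian_cubic:
  "p_laplacian p cubic x =
    54 * ((m x x \<bullet> m x x) * mult_trace x + (p - 2) * (m x x \<bullet> m x (m x x)))"
proof -
  have "gradient (\<lambda>y. (norm (gradient cubic y))\<^sup>2) x = 36 *\<^sub>R m x (m x x)"
  proof (rule gradient_eqI)
    have "((\<lambda>y. 9 * (m y y \<bullet> m y y)) has_derivative
        (\<lambda>h. 9 * (m x x \<bullet> (2 *\<^sub>R m x h) + (2 *\<^sub>R m x h) \<bullet> m x x))) (at x)"
      by (intro derivative_intros square_has_derivative)
    moreover have "m x x \<bullet> m x h = h \<bullet> m x (m x x)" for h
      by (metis self_adjoint inner_commute)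
    ultimately show "GDERIV (\<lambda>y. (norm (gradient cubic y))\<^sup>2) x :> 36 *\<^sub>R m x (m x x)"
      by (simp add: gderiv_def gradient_cubic power2_norm_eq_inner inner_commute)
  qed
  then show ?thesis
    by (simp add: p_laplacian_def laplacian_cubic gradient_cubic power2_norm_eq_inner field_simps)
qed

end

theorem theorem1p2:
  fixes u :: "real ^ 'n \<Rightarrow> real" and p :: real
  assumes "CARD('n) \<ge> 2"
    and "homogeneous_polynomial 3 u"
    and "p \<notin> {1, 2}"
    and "\<forall>x. p_laplacian p u x = 0"
  shows "\<forall>x. u x = 0"
proof -
  obtain m where alg: "metrized_algebra m" and u: "u = metrized_algebra.cubic m"
    using cubic_form_algebra assms(2) by blast
  interpret metrized_algebra m by (fact alg)
  have "(m x x \<bullet> m x x) * mult_trace x + (p - 2) * (m x x \<bullet> m x (m x x)) = 0" for x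
    using assms(4) by (simp add: u p_laplacian_cubic[OF alg] del: distrib_left_numeral)
  then have "cubic x = 0" for x
    by (rule cubic_zero_if_trace_identity) (use assms(3) in auto)
  then show ?thesis
    by (simp add: u)
qed

end
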